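(* Consider the second-order control system, the set $\mathcal{C}$, the parameters $\gamma,\epsilon>0$, the functions $B_i$ and $B$, and the set $\mathcal{C}^s=\{x\in\mathbb{R}^{2n}: B(x)\ge 0\}$ described in the context, with admissible input set $\mathcal{U}\subseteq\mathbb{R}^m$. Suppose that for every $x=(x_1,x_2)\in\partial\mathcal{C}^s$ there exists $u_x\in\mathcal{U}$ such that $$a_{i'}^\top\big(\gamma x_2+f_2(x)+G_2(x)u_x\big)>0$$ for all $i'\in\{1,\dots,r\}$ with $i'+r\in\tilde{\mathcal{I}}(x)$ and $B_{i'+r}(x)=0$. Then the General Safety Condition holds: for each $x\in\partial\mathcal{C}^s$ there exists $u_x\in\mathcal{U}$ such that $$\nabla B_i(x)^\top\big(f(x)+G(x)u_x\big)>0\quad\text{for all } i\in\tilde{\mathcal{I}}(x).$$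
   Context: Dynamics: $\dot x=f(x)+G(x)u$ with $x=(x_1,x_2)$, $x_1,x_2\in\mathbb{R}^n$, $u\in\mathbb{R}^m$, $f(x)=(x_2,f_2(x))$, $G(x)=(\mathbf{0}_{n\times m},G_2(x))$ (stacked blocks), where $f_2:\mathbb{R}^{2n}\to\mathbb{R}^n$ and $G_2:\mathbb{R}^{2n}\to\mathbb{R}^{n\times m}$ are Lipschitz. $\mathcal{U}\subseteq\mathbb{R}^m$ is the set of allowable inputs. Half-spaces: let $\mathcal{I}=\{1,\dots,r\}$. For $i\in\mathcal{I}$, let $a_i\in\mathbb{R}^n$, $b_i\in\mathbb{R}$ with $\|a_i\|\ne 0$ and $b_i\neq 0$, such that for $i\ne i'$ the augmented vectors $(a_i,b_i)$ and $(a_{i'},b_{i'})$ are linearly independent. Set $h_i(x)=a_i^\top x_1+b_i$ and $\mathcal{C}_i=\{x\in\mathbb{R}^{2n} : h_i(x)\ge 0\}$. Desired safe set: $\mathcal{L}\subset\mathbb{N}$ is a nonempty finite index set and $\mathcal{I}^\ell\subseteq\mathcal{I}$ is nonempty for each $\ell\in\mathcal{L}$. Set $\mathcal{C}=\bigcup_{\ell\in\mathcal{L}}\bigcap_{i\in\mathcal{I}^\ell}\mathcal{C}_i$. Construction of $B$: given parameters $\gamma,\epsilon>0$, for $1\le i\le r$ put $B_i(x)=h_i(x)$ and $B_{i+r}(x)=a_i^\top x_2+\gamma(a_i^\top x_1+b_i)-\epsilon$. Put $\bar{\mathcal{L}}=\mathcal{L}$, $\bar{\mathcal{I}}^\ell=\mathcal{I}^\ell\cup\{i+r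 : i\in\mathcal{I}^\ell\}$, $B^\ell(x)=\min_{i\in\bar{\mathcal{I}}^\ell}B_i(x)$, and $B(x)=\max_{\ell\in\bar{\mathcal{L}}}B^\ell(x)$. Active indices: $\mathcal{L}_i=\{\ell\in\bar{\mathcal{L}} : i\in\bar{\mathcal{I}}^\ell\}$ and $\tilde{\mathcal{I}}(x)=\{i\in\{1,\dots,2r\} : \exists\,\ell\in\mathcal{L}_i \text{ with } B(x)=B^\ell(x)=B_i(x)\}$. $\partial\mathcal{C}^s$ denotes the boundary of $\mathcal{C}^s$ in $\mathbb{R}^{2n}$. *)

theory Defs
  imports "HOL-Analysis.Analysis"
begin

text \<open>
  The state space \<open>\<real>\<^bsup>2n\<^esup>\<close> is the product \<open>(real ^ 'n) \<times> (real ^ 'n)\<close>, which carries the Euclidean inner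
  product, norm and topology; \<open>fst x\<close> and \<open>snd x\<close> are the blocks \<open>x\<^sub>1\<close> and \<open>x\<^sub>2\<close>.
\<close>

type_synonym 'n state = "(real ^ 'n) \<times> (real ^ 'n)"

definition gradient :: "('s::real_inner \<Rightarrow> real) \<Rightarrow> 's \<Rightarrow> 's" where
  "gradient F x = (THE D. GDERIV F x :> D)"

definition drift :: "('n state \<Rightarrow> real ^ 'n) \<Rightarrow> 'n::finite state \<Rightarrow> 'n state" where
  "drift f2 x = (snd x, f2 x)"

text \<open>
  A \<open>2n \<times> m\<close> matrix is kept as the pair of its upper and lower \<open>n \<times> m\<close> blocks.
\<close>

type_synonym ('n, 'm) stacked = "(real ^ 'm ^ 'n) \<times> (real ^ 'm ^ 'n)"

definition stacked_mult :: "('n::finite, 'm::finite) stacked \<Rightarrow> real ^ 'm \<Rightarrow> 'n state" where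
  "stacked_mult M u = (fst M *v u, snd M *v u)"

definition input_matrix ::
    "('n state \<Rightarrow> real ^ 'm ^ 'n) \<Rightarrow> 'n::finite state \<Rightarrow> ('n, 'm::finite) stacked" where
  "input_matrix G2 x = (0, G2 x)"

definition halfspace_fun ::
    "(nat \<Rightarrow> real ^ 'n) \<Rightarrow> (nat \<Rightarrow> real) \<Rightarrow> nat \<Rightarrow> 'n::finite state \<Rightarrow> real" where
  "halfspace_fun a b i x = a i \<bullet> fst x + b i"

text \<open>
  Distinctness is required separately because \<open>independent\<close> speaks about sets and would not
  detect that the two augmented vectors coincide.
\<close>

definition halfspace_data :: "nat \<Rightarrow> (nat \<Rightarrow> real ^ 'n::finite) \<Rightarrow> (nat \<Rightarrow> real) \<Rightarrow> bool" where
  "halfspace_data r a b \<longleftrightarrow>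
     (\<forall>i\<in>{1..r}. norm (a i) \<noteq> 0 \<and> b i \<noteq> 0) \<and>
     (\<forall>i\<in>{1..r}. \<forall>j\<in>{1..r}. i \<noteq> j \<longrightarrow>
        (a i, b i) \<noteq> (a j, b j) \<and> independent {(a i, b i), (a j, b j)})"

text \<open>
  The set \<open>\<C>\<close> that \<open>super_level_set\<close> below is built to under-approximate; the safety condition
  depends on it only through the data \<open>a\<close>, \<open>b\<close>, \<open>L\<close>, \<open>I\<close>.
\<close>

definition desired_safe_set ::
    "(nat \<Rightarrow> real ^ 'n) \<Rightarrow> (nat \<Rightarrow> real) \<Rightarrow> nat set \<Rightarrow> (nat \<Rightarrow> nat set) \<Rightarrow> 'n::finite state set" where
  "desired_safe_set a b L I = (\<Union>l\<in>L. \<Inter>i\<in>I l. {x. halfspace_fun a b i x \<ge> 0})"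

definition min_fun :: "(nat \<Rightarrow> 's \<Rightarrow> real) \<Rightarrow> (nat \<Rightarrow> nat set) \<Rightarrow> nat \<Rightarrow> 's \<Rightarrow> real" where
  "min_fun B I l x = Min ((\<lambda>i. B i x) ` I l)"

definition maxmin_fun ::
    "(nat \<Rightarrow> 's \<Rightarrow> real) \<Rightarrow> nat set \<Rightarrow> (nat \<Rightarrow> nat set) \<Rightarrow> 's \<Rightarrow> real" where
  "maxmin_fun B L I x = Max ((\<lambda>l. min_fun B I l x) ` L)"

definition super_level_set ::
    "(nat \<Rightarrow> 's \<Rightarrow> real) \<Rightarrow> nat set \<Rightarrow> (nat \<Rightarrow> nat set) \<Rightarrow> 's set" where
  "super_level_set B L I = {x. maxmin_fun B L I x \<ge> 0}"

definition active_indices ::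
    "nat \<Rightarrow> (nat \<Rightarrow> 's \<Rightarrow> real) \<Rightarrow> nat set \<Rightarrow> (nat \<Rightarrow> nat set) \<Rightarrow> 's \<Rightarrow> nat set" where
  "active_indices N B L I x =
     {i \<in> {1..N}. \<exists>l \<in> {l \<in> L. i \<in> I l}.
        maxmin_fun B L I x = min_fun B I l x \<and> min_fun B I l x = B i x}"

definition general_safety_condition ::
    "(real ^ 'm::finite) set \<Rightarrow> ('n state \<Rightarrow> 'n state) \<Rightarrow> ('n state \<Rightarrow> ('n, 'm) stacked) \<Rightarrow>
     nat \<Rightarrow> (nat \<Rightarrow> 'n::finite state \<Rightarrow> real) \<Rightarrow> nat set \<Rightarrow> (nat \<Rightarrow> nat set) \<Rightarrow> bool" where
  "general_safety_condition U f G N B L I \<longleftrightarrow>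
     (\<forall>x \<in> frontier (super_level_set B L I). \<exists>u\<in>U.
        \<forall>i \<in> active_indices N B L I x.
          gradient (B i) x \<bullet> (f x + stacked_mult (G x) u) > 0)"

definition barrier ::
    "nat \<Rightarrow> (nat \<Rightarrow> real ^ 'n) \<Rightarrow> (nat \<Rightarrow> real) \<Rightarrow> real \<Rightarrow> real \<Rightarrow> nat \<Rightarrow> 'n::finite state \<Rightarrow> real" where
  "barrier r a b \<gamma> \<epsilon> i x =
     (if i \<le> r then halfspace_fun a b i x
      else a (i - r) \<bullet> snd x + \<gamma> * (a (i - r) \<bullet> fst x + b (i - r)) - \<epsilon>)"

definition extended_index :: "nat \<Rightarrow> (nat \<Rightarrow> nat set) \<Rightarrow> nat \<Rightarrow> nat set" where
  "extended_index r I l = I l \<union> (\<lambda>i. i + r) ` I l"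

end

theory Submission imports Defs begin

text \<open>
  On the boundary of the safe set the barrier vanishes by continuity, so every active \<open>B\<^sub>i\<close> vanishes.
  For an active velocity index \<open>i + r\<close> the inequality is the hypothesis.  For an active position
  index \<open>i \<le> r\<close> the minimum that attains the barrier value also ranges over \<open>i + r\<close>, so
  \<open>B\<^sub>i\<^sub>+\<^sub>r \<ge> 0\<close> while \<open>h\<^sub>i = 0\<close>; this forces the derivative \<open>a\<^sub>i \<bullet> x\<^sub>2\<close> of \<open>h\<^sub>i\<close> to be at least \<open>\<epsilon>\<close>,
  whatever the input.
\<close>

text \<open>Derivatives are unique and the inner product is nondegenerate, so the definite
  description in \<open>gradient\<close> can be evaluated from any one derivative.\<close>

lemma gradient_eqI:
  assumes "GDERIV F x :> D"
  shows "gradient F x = D"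
  unfolding gradient_def
proof (rule the_equality)
  fix D' assume "GDERIV F x :> D'"
  with assms have "(\<lambda>h. h \<bullet> D') = (\<lambda>h. h \<bullet> D)"
    unfolding gderiv_def by (blast intro: has_derivative_unique)
  then show "D' = D"
    by (metis vector_eq_rdot inner_commute)
qed (fact assms)

lemma gradient_barrier_position:
  fixes x :: "'n::finite state"
  assumes "i \<le> r"
  shows "gradient (barrier r a b \<gamma> \<epsilon> i) x = (a i, 0)"
proof (rule gradient_eqI)
  show "GDERIV (barrier r a b \<gamma> \<epsilon> i) x :> (a i, 0)"
    unfolding gderiv_def barrier_def halfspace_fun_def using assms
    by (auto intro!: derivative_eq_intros simp: inner_prod_def inner_commute)
qed

text \<open>Positivity of \<open>i\<close> pushes \<open>i + r\<close> beyond \<open>r\<close>, into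
  the second branch of \<open>barrier\<close>; the index \<open>r\<close> itself is still a position
  index.\<close>

lemma gradient_barrier_velocity:
  fixes x :: "'n::finite state"
  assumes "i > 0"
  shows "gradient (barrier r a b \<gamma> \<epsilon> (i + r)) x = (\<gamma> *\<^sub>R a i, a i)"
proof (rule gradient_eqI)
  show "GDERIV (barrier r a b \<gamma> \<epsilon> (i + r)) x :> (\<gamma> *\<^sub>R a i, a i)"
    unfolding gderiv_def barrier_def using assms
    by (auto intro!: derivative_eq_intros
        simp: inner_prod_def inner_commute algebra_simps)
qed

lemma continuous_on_Max_image:
  fixes F :: "'i \<Rightarrow> 's::topological_space \<Rightarrow> 'b::linorder_topology"
  assumes "finite A" "A \<noteq> {}" "\<And>i. i \<in> A \<Longrightarrow> continuous_on S (F i)"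
  shows "continuous_on S (\<lambda>x. Max ((\<lambda>i. F i x) ` A))"
  using assms by (induction A rule: finite_ne_induct) (auto intro!: continuous_on_max)

lemma continuous_on_Min_image:
  fixes F :: "'i \<Rightarrow> 's::topological_space \<Rightarrow> 'b::linorder_topology"
  assumes "finite A" "A \<noteq> {}" "\<And>i. i \<in> A \<Longrightarrow> continuous_on S (F i)"
  shows "continuous_on S (\<lambda>x. Min ((\<lambda>i. F i x) ` A))"
  using assms by (induction A rule: finite_ne_induct) (auto intro!: continuous_on_min)

lemma continuous_on_maxmin_fun:
  fixes B :: "nat \<Rightarrow> 's::topological_space \<Rightarrow> real"
  assumes "finite L" "L \<noteq> {}"
    and "\<And>l. l \<in> L \<Longrightarrow> finite (I l) \<and> I l \<noteq> {}"
    and "\<And>i. continuous_on S (B i)"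
  shows "continuous_on S (maxmin_fun B L I)"
  unfolding maxmin_fun_def min_fun_def using assms
  by (intro continuous_on_Max_image continuous_on_Min_image) auto

lemma continuous_on_barrier: "continuous_on S (barrier r a b \<gamma> \<epsilon> i)"
  unfolding barrier_def halfspace_fun_def
  by (cases "i \<le> r") (auto intro!: continuous_intros)

text \<open>The superlevel set is closed, so it contains its frontier; the open set where
  \<open>F\<close> is positive lies in the interior, so the frontier avoids it.\<close>

lemma frontier_superlevel_zero:
  fixes F :: "'s::topological_space \<Rightarrow> real"
  assumes F: "continuous_on UNIV F" and x: "x \<in> frontier {x. F x \<ge> 0}"
  shows "F x = 0"
proof -
  have "closed {x. 0 \<le> F x}" and op: "open {x. 0 < F x}"
    using F by (auto intro: closed_Collect_le open_Collect_less)
  then have "closure {x. 0 \<le> F x} = {x. 0 \<le> F x}"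
    by simp
  moreover have "{x. 0 < F x} \<subseteq> interior {x. 0 \<le> F x}"
    by (rule interior_maximal[OF _ op]) auto
  ultimately have "0 \<le> F x" "\<not> 0 < F x"
    using x unfolding frontier_def by blast+
  then show ?thesis
    by simp
qed

theorem mainTheorem3:
  fixes f2 :: "'n::finite state \<Rightarrow> real ^ 'n"
    and G2 :: "'n state \<Rightarrow> real ^ 'm::finite ^ 'n"
    and U :: "(real ^ 'm) set"
    and r :: nat
    and a :: "nat \<Rightarrow> real ^ 'n"
    and b :: "nat \<Rightarrow> real"
    and L :: "nat set"
    and I :: "nat \<Rightarrow> nat set"
    and \<gamma> \<epsilon> :: real
  defines "B \<equiv> barrier r a b \<gamma> \<epsilon>"
    and "Ibar \<equiv> extended_index r I"
  assumes "\<exists>K. K-lipschitz_on UNIV f2"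
    and "\<exists>K. K-lipschitz_on UNIV G2"
    and "halfspace_data r a b"
    and "finite L" and "L \<noteq> {}"
    and "\<And>l. l \<in> L \<Longrightarrow> I l \<subseteq> {1..r} \<and> I l \<noteq> {}"
    and "\<gamma> > 0" and "\<epsilon> > 0"
    and "\<And>x. x \<in> frontier (super_level_set B L Ibar) \<Longrightarrow>
           \<exists>u\<in>U. \<forall>i\<in>{1..r}.
             i + r \<in> active_indices (2 * r) B L Ibar x \<and> B (i + r) x = 0 \<longrightarrow>
             a i \<bullet> (\<gamma> *\<^sub>R snd x + f2 x + G2 x *v u) > 0"
  shows "general_safety_condition U (drift f2) (input_matrix G2) (2 * r) B L Ibar"
  unfolding general_safety_condition_def
proof
  note I = assms(8)
  fix x assume x: "x \<in> frontier (super_level_set B L Ibar)"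
  have fin: "finite (Ibar l) \<and> Ibar l \<noteq> {}" if "l \<in> L" for l
    using I[OF that] finite_subset[of "I l" "{1..r}"] by (auto simp: Ibar_def extended_index_def)
  have "continuous_on UNIV (maxmin_fun B L Ibar)"
    using assms(6,7) fin by (intro continuous_on_maxmin_fun) (auto simp: B_def continuous_on_barrier)
  then have zero: "maxmin_fun B L Ibar x = 0"
    using frontier_superlevel_zero x unfolding super_level_set_def by blast
  \<comment> \<open>The input is fixed before any active index is considered, since a single
    \<open>u\<close> must serve them all.\<close>
  from assms(11)[OF x] obtain u where "u \<in> U" and u:
    "\<And>i. \<lbrakk>i \<in> {1..r}; i + r \<in> active_indices (2 * r) B L Ibar x; B (i + r) x = 0\<rbrakk>
      \<Longrightarrow> a i \<bullet> (\<gamma> *\<^sub>R snd x + f2 x + G2 x *v u) > 0"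
    by blast
  have "gradient (B i) x \<bullet> (drift f2 x + stacked_mult (input_matrix G2 x) u) > 0"
    if i: "i \<in> active_indices (2 * r) B L Ibar x" for i
  proof -
    from i zero obtain l where l: "l \<in> L" "i \<in> Ibar l" "min_fun B Ibar l x = 0"
      and Bi: "B i x = 0" and "i \<in> {1..2 * r}"
      unfolding active_indices_def by auto
    show ?thesis
    proof (cases "i \<le> r")
      case True
      \<comment> \<open>Shifted indices exceed \<open>r\<close> because \<open>I l\<close> starts at
        1 or later. Hence \<open>i\<close> comes from \<open>I l\<close> itself, and its partner
        \<open>i + r\<close> lies in the same \<open>Ibar l\<close>.\<close>
      with l I[of l] have "i + r \<in> Ibar l" and "i > 0"
        by (fastforce simp: Ibar_def extended_index_def)+
      then have "B (i + r) x \<ge> 0"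
        using l fin[of l] Min_le[of "(\<lambda>i. B i x) ` Ibar l"] by (auto simp: min_fun_def)
      \<comment> \<open>As \<open>h\<^sub>i x = 0\<close>, nonnegativity of \<open>B\<^sub>i\<^sub>+\<^sub>r\<close> leaves \<open>a\<^sub>i \<bullet> x\<^sub>2 \<ge> \<epsilon>\<close>.\<close>
      with Bi True \<open>i > 0\<close> have "a i \<bullet> snd x \<ge> \<epsilon>"
        by (simp add: B_def barrier_def halfspace_fun_def)
      with \<open>\<epsilon> > 0\<close> show ?thesis
        using True by (simp add: B_def gradient_barrier_position drift_def stacked_mult_def
            input_matrix_def)
    next
      case False
      define j where "j = i - r"
      have j: "i = j + r" "j \<in> {1..r}"
        using False \<open>i \<in> {1..2 * r}\<close> by (auto simp: j_def)
      with u[of j] i Bi have "a j \<bullet> (\<gamma> *\<^sub>R snd x + f2 x + G2 x *v u) > 0"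
        by simp
      \<comment> \<open>Pairing the gradient \<open>(\<gamma> *\<^sub>R a j, a j)\<close> with the
        closed-loop field gives exactly the expression in the hypothesis.\<close>
      with j show ?thesis
        by (simp add: B_def gradient_barrier_velocity drift_def stacked_mult_def input_matrix_def
            inner_add_right)
    qed
  qed
  with \<open>u \<in> U\<close> show "\<exists>u\<in>U. \<forall>i\<in>active_indices (2 * r) B L Ibar x.
      gradient (B i) x \<bullet> (drift f2 x + stacked_mult (input_matrix G2 x) u) > 0"
    by blast
qed

end
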